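(* Let $(X,d)$ be a Ptolemy space and let $p\in X$. For $x,y\in X$ put $$S_p(x,y)=\log\left(1+\frac{d(x,y)}{[1+d(x,p)][1+d(y,p)]}\right).$$ Then $(X,S_p)$ is a strongly hyperbolic metric space with parameter $\epsilon=2$. Consequently, $(X,S_p)$ is a $\frac{\log 2}{2}$-hyperbolic space.
   Context: A metric space $(X,d)$ is called a Ptolemy space if $d(x_1,x_2)d(x_3,x_4)\leq d(x_1,x_4)d(x_2,x_3)+d(x_1,x_3)d(x_2,x_4)$ for all $x_1,x_2,x_3,x_4\in X$. For a metric space $(Y,\rho)$ and $x,y,o\in Y$, the Gromov product is $(x|y)_o=\frac12(\rho(o,x)+\rho(o,y)-\rho(x,y))$. $(Y,\rho)$ is $\delta$-hyperbolic ($\delta\geq 0$) if $(x|y)_o\geq \min\{(x|z)_o,(z|y)_o\}-\delta$ for all $x,y,z,o\in Y$. $(Y,\rho)$ is strongly hyperbolic with parameter $\epsilon>0$ if $\exp(-\epsilon(x|y)_o)\leq \exp(-\epsilon(x|z)_o)+\exp(-\epsilon(z|y)_o)$ for all $x,y,z,o\in Y$; equivalently, $\exp(\frac{\epsilon}{2}(\rho(x,y)+\rho(z,t)))\leq \exp(\frac{\epsilon}{2}(\rho(x,z)+\rho(y,t)))+\exp(\frac{\epsilon}{2}(\rho(x,t)+\rho(z,y)))$ for all $x,y,z,t\in Y$. *)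

theory Defs
  imports "HOL-Analysis.Analysis"
begin

locale Ptolemy_space = Metric_space +
  assumes ptolemy:
    "\<lbrakk>x1 \<in> M; x2 \<in> M; x3 \<in> M; x4 \<in> M\<rbrakk> \<Longrightarrow>
      d x1 x2 * d x3 x4 \<le> d x1 x4 * d x2 x3 + d x1 x3 * d x2 x4"

definition gromov_product :: "('a \<Rightarrow> 'a \<Rightarrow> real) \<Rightarrow> 'a \<Rightarrow> 'a \<Rightarrow> 'a \<Rightarrow> real" where
  "gromov_product d w x y = (d w x + d w y - d x y) / 2"

locale hyperbolic_space = Metric_space +
  fixes \<delta> :: real
  assumes delta_nonneg: "0 \<le> \<delta>"
    and hyperbolic:
    "\<lbrakk>x \<in> M; y \<in> M; z \<in> M; w \<in> M\<rbrakk> \<Longrightarrow>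
      gromov_product d w x y \<ge> min (gromov_product d w x z) (gromov_product d w z y) - \<delta>"

locale strongly_hyperbolic_space = Metric_space +
  fixes \<epsilon> :: real
  assumes epsilon_pos: "0 < \<epsilon>"
    and strongly_hyperbolic:
    "\<lbrakk>x \<in> M; y \<in> M; z \<in> M; w \<in> M\<rbrakk> \<Longrightarrow>
      exp (- \<epsilon> * gromov_product d w x y)
        \<le> exp (- \<epsilon> * gromov_product d w x z) + exp (- \<epsilon> * gromov_product d w z y)"

definition S_metric :: "('a \<Rightarrow> 'a \<Rightarrow> real) \<Rightarrow> 'a \<Rightarrow> 'a \<Rightarrow> 'a \<Rightarrow> real" where
  "S_metric d p x y = ln (1 + d x y / ((1 + d x p) * (1 + d y p)))"

end

theory Submission
  imports Defs
begin

text \<open>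
  Write \<open>S_p = log (1 + s)\<close> with \<open>s x y = d x y / ((1 + d x p) * (1 + d y p))\<close>. Two
  facts about \<open>s\<close> give the theorem.

  First, \<open>s\<close> is again a Ptolemy metric (\<open>Ptolemy_space_chordal\<close>). Ptolemy's inequality is
  homogeneous: each of its three terms contains every one of the four points exactly once, so
  rescaling by a weight at each point preserves it. After clearing denominators, the triangle
  inequality of \<open>s\<close> is the sum of the triangle inequality of \<open>d\<close> and of Ptolemy's inequality
  for the three points and \<open>p\<close>.

  Second, \<open>log (1 + s)\<close> is strongly hyperbolic with parameter 2 for every Ptolemy metric \<open>s\<close>
  (\<open>strongly_hyperbolic_log_one_plus\<close>). In exponential form the claim is
  \<open>(1 + s x y) * (1 + s z w) \<le> (1 + s x z) * (1 + s w y) + (1 + s z y) * (1 + s w x)\<close>,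
  where Ptolemy's inequality controls the quadratic terms and triangle inequalities the linear ones.

  The passage from strong hyperbolicity to Gromov hyperbolicity bounds a sum of two exponentials
  by twice the larger one, which costs the constant \<open>log 2 / \<epsilon>\<close>.
\<close>

text \<open>
  The name recalls the chordal metric of the plane, likewise the Euclidean distance divided by
  a weight at each of the two points.
\<close>

definition chordal :: "('a \<Rightarrow> 'a \<Rightarrow> real) \<Rightarrow> 'a \<Rightarrow> 'a \<Rightarrow> 'a \<Rightarrow> real" where
  "chordal d p x y = d x y / ((1 + d x p) * (1 + d y p))"

lemma Ptolemy_space_chordal:
  assumes "Ptolemy_space M d" and p: "p \<in> M"
  shows "Ptolemy_space M (chordal d p)"
proof -
  interpret Ptolemy_space M d by fact
  have pos: "0 < 1 + d x p" for x
    using nonneg[of x p] by linarith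
  show ?thesis
  proof
    show "0 \<le> chordal d p x y" for x y
      using pos[of x] pos[of y] by (simp add: chordal_def)
    show "chordal d p x y = chordal d p y x" for x y
      by (simp add: chordal_def commute mult.commute)
    show "chordal d p x y = 0 \<longleftrightarrow> x = y" if "x \<in> M" "y \<in> M" for x y
      using that pos[of x] pos[of y] by (simp add: chordal_def)
    show "chordal d p x z \<le> chordal d p x y + chordal d p y z"
      if "x \<in> M" "y \<in> M" "z \<in> M" for x y z
    proof -
      have "d x z * (1 + d y p) \<le> d x y * (1 + d z p) + d y z * (1 + d x p)"
        using triangle[OF that] ptolemy[of x z y p] that p
        by (simp add: algebra_simps commute)
      then have "d x z * (1 + d y p) / ((1 + d x p) * (1 + d y p) * (1 + d z p))
        \<le> (d x y * (1 + d z p) + d y z * (1 + d x p)) / ((1 + d x p) * (1 + d y p) * (1 + d z p))"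
        using pos[of x] pos[of y] pos[of z] by (intro divide_right_mono) auto
      then show ?thesis
        using pos[of x] pos[of y] pos[of z]
        by (simp add: chordal_def add_divide_distrib mult.commute mult.left_commute)
    qed
    show "chordal d p x1 x2 * chordal d p x3 x4
        \<le> chordal d p x1 x4 * chordal d p x2 x3 + chordal d p x1 x3 * chordal d p x2 x4"
      if "x1 \<in> M" "x2 \<in> M" "x3 \<in> M" "x4 \<in> M" for x1 x2 x3 x4
    proof -
      let ?c = "(1 + d x1 p) * (1 + d x2 p) * (1 + d x3 p) * (1 + d x4 p)"
      have "d x1 x2 * d x3 x4 / ?c \<le> (d x1 x4 * d x2 x3 + d x1 x3 * d x2 x4) / ?c"
        using ptolemy[OF that] pos[of x1] pos[of x2] pos[of x3] pos[of x4]
        by (intro divide_right_mono) auto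
      then show ?thesis
        by (simp add: chordal_def add_divide_distrib mult_ac)
    qed
  qed
qed

text \<open>
  Each of the distances \<open>s x y\<close> and \<open>s z w\<close> can be bounded by going through either of the two
  remaining points. Averaging these bounds gives
  \<open>s x y + s z w \<le> s x z + s y w + s x w + s y z\<close>, which is the part of the inequality that
  is linear in \<open>s\<close>.
\<close>

lemma Ptolemy_one_plus_four_point:
  assumes "Ptolemy_space M s" and "x \<in> M" "y \<in> M" "z \<in> M" "w \<in> M"
  shows "(1 + s x y) * (1 + s z w)
    \<le> (1 + s x z) * (1 + s w y) + (1 + s z y) * (1 + s w x)"
proof -
  interpret Ptolemy_space M s by fact
  have "s x y \<le> s x z + s z y" "s x y \<le> s x w + s w y"
    "s z w \<le> s z x + s x w" "s z w \<le> s z y + s y w"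
    using assms(2-) triangle by blast+
  moreover have "s x y * s z w \<le> s x w * s y z + s x z * s y w"
    using assms(2-) by (rule ptolemy)
  ultimately show ?thesis
    by (simp add: algebra_simps commute)
qed

lemma strongly_hyperbolic_log_one_plus:
  assumes "Ptolemy_space M s"
  shows "strongly_hyperbolic_space M (\<lambda>x y. ln (1 + s x y)) 2"
proof -
  interpret Ptolemy_space M s by fact
  have pos: "0 < 1 + s x y" for x y
    using nonneg[of x y] by linarith
  show ?thesis
  proof
    show "0 \<le> ln (1 + s x y)" for x y
      by simp
    show "ln (1 + s x y) = ln (1 + s y x)" for x y
      by (simp add: commute)
    show "ln (1 + s x y) = 0 \<longleftrightarrow> x = y" if "x \<in> M" "y \<in> M" for x y
      using that pos[of x y] by simp
    show "ln (1 + s x z) \<le> ln (1 + s x y) + ln (1 + s y z)"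
      if "x \<in> M" "y \<in> M" "z \<in> M" for x y z
    proof -
      have "1 + s x z \<le> (1 + s x y) * (1 + s y z)"
        using add_mono[OF triangle[OF that] mult_nonneg_nonneg[OF nonneg[of x y] nonneg[of y z]]]
        by (simp add: algebra_simps)
      then have "ln (1 + s x z) \<le> ln ((1 + s x y) * (1 + s y z))"
        using pos[of x z] by simp
      then show ?thesis
        using pos[of x y] pos[of y z] by (simp add: ln_mult)
    qed
    show "(0::real) < 2"
      by simp
    have exp_gromov: "exp (- 2 * gromov_product (\<lambda>x y. ln (1 + s x y)) w x y)
        = (1 + s x y) / ((1 + s w x) * (1 + s w y))" for w x y
    proof -
      have "- 2 * gromov_product (\<lambda>x y. ln (1 + s x y)) w x y
          = ln (1 + s x y) - (ln (1 + s w x) + ln (1 + s w y))"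
        by (simp add: gromov_product_def)
      then show ?thesis
        using pos[of x y] pos[of w x] pos[of w y] by (simp only: exp_diff exp_add exp_ln)
    qed
    show "exp (- 2 * gromov_product (\<lambda>x y. ln (1 + s x y)) w x y)
        \<le> exp (- 2 * gromov_product (\<lambda>x y. ln (1 + s x y)) w x z)
          + exp (- 2 * gromov_product (\<lambda>x y. ln (1 + s x y)) w z y)"
      if "x \<in> M" "y \<in> M" "z \<in> M" "w \<in> M" for x y z w
    proof -
      let ?c = "(1 + s w x) * (1 + s w y) * (1 + s w z)"
      have "(1 + s x y) * (1 + s w z) / ?c
          \<le> ((1 + s x z) * (1 + s w y) + (1 + s z y) * (1 + s w x)) / ?c"
        using Ptolemy_one_plus_four_point[OF assms that] pos[of w x] pos[of w y] pos[of w z]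
        by (intro divide_right_mono) (auto simp: commute)
      then show ?thesis
        unfolding exp_gromov
        using pos[of w x] pos[of w y] pos[of w z]
        by (simp add: add_divide_distrib mult.commute mult.left_commute)
    qed
  qed
qed

lemma strongly_hyperbolic_imp_hyperbolic:
  assumes "strongly_hyperbolic_space M \<rho> \<epsilon>"
  shows "hyperbolic_space M \<rho> (ln 2 / \<epsilon>)"
proof -
  interpret strongly_hyperbolic_space M \<rho> \<epsilon> by fact
  show ?thesis
  proof
    show "0 \<le> ln 2 / \<epsilon>"
      using epsilon_pos by simp
    show "min (gromov_product \<rho> w x z) (gromov_product \<rho> w z y) - ln 2 / \<epsilon>
        \<le> gromov_product \<rho> w x y"
      if "x \<in> M" "y \<in> M" "z \<in> M" "w \<in> M" for x y z w
    proof -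
      let ?m = "min (gromov_product \<rho> w x z) (gromov_product \<rho> w z y)"
      have "exp (- \<epsilon> * gromov_product \<rho> w x y)
          \<le> exp (- \<epsilon> * gromov_product \<rho> w x z) + exp (- \<epsilon> * gromov_product \<rho> w z y)"
        using that by (rule strongly_hyperbolic)
      also have "\<dots> \<le> exp (- \<epsilon> * ?m) + exp (- \<epsilon> * ?m)"
        using epsilon_pos by (intro add_mono) (auto intro: mult_left_mono)
      also have "\<dots> = exp (ln 2 - \<epsilon> * ?m)"
        by (simp add: exp_diff exp_minus field_simps)
      finally have "\<epsilon> * ?m - ln 2 \<le> \<epsilon> * gromov_product \<rho> w x y"
        by simp
      then show ?thesis
        using epsilon_pos by (simp add: field_simps)
    qed
  qed
qed

theorem theorem4:
  fixes X :: "'a set" and d :: "'a \<Rightarrow> 'a \<Rightarrow> real" and p :: 'a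
  assumes "Ptolemy_space X d" and "p \<in> X"
  shows "strongly_hyperbolic_space X (S_metric d p) 2 \<and>
         hyperbolic_space X (S_metric d p) (ln 2 / 2)"
proof -
  have "S_metric d p = (\<lambda>x y. ln (1 + chordal d p x y))"
    by (intro ext) (simp add: S_metric_def chordal_def)
  then have "strongly_hyperbolic_space X (S_metric d p) 2"
    using strongly_hyperbolic_log_one_plus[OF Ptolemy_space_chordal[OF assms]] by simp
  then show ?thesis
    using strongly_hyperbolic_imp_hyperbolic by blast
qed

end
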